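(* Let $\alpha\in\mathbb{R}\setminus\{0\}$, $\beta>0$, let $\mathbf{X}\in\mathbb{T}_{\alpha\beta}^{p\times p}$ and let $(\mathbf{P},\mathbf{L},\mathbf{U})$ be the matrices of the LU factorization with partial pivoting of $\mathbf{X}$ constructed in the context, with associated signature vectors $\boldsymbol\gamma_2=[\gamma_s,\gamma_d]$ (if $\alpha<0$) or $\boldsymbol\gamma_1=[\gamma_{s1},\gamma_{d1},\gamma_{s2},\gamma_{d2}]$ (if $\alpha>0$). Then: 1. $\det(\mathbf{P})$ is given as follows. If $\alpha<0$: $\det(\mathbf{P})=1,\ -1,\ \frac{1}{\sqrt\beta}\mathrm{j},\ -\frac{1}{\sqrt\beta}\mathrm{j}$ for $\boldsymbol\gamma_2=[1,1],\ [-1,-1],\ [1,-1],\ [-1,1]$, respectively. If $\alpha>0$, put $a_1=\frac12\big(1+\frac{1}{\sqrt\alpha}\mathrm{i}+\frac1{\sqrt\beta}\mathrm{j}-\frac1{\sqrt{\alpha\beta}}\mathrm{k}\big)$ and $a_2=\frac12\big(-1+\frac{1}{\sqrt\alpha}\mathrm{i}+\frac1{\sqrt\beta}\mathrm{j}+\frac1{\sqrt{\alpha\beta}}\mathrm{k}\big)$. Then $\det(\mathbf{P})$ equals: $1$ for $[1,1,1,1]$; $-1$ for $[-1,-1,-1,-1]$; $\frac1{\sqrt\alpha}\mathrm{i}$ for $[1,-1,1,-1]$; $-\frac1{\sqrt\alpha}\mathrm{i}$ for $[-1,1,-1,1]$; $\frac1{\sqrt\beta}\mathrm{j}$ for $[1,1,-1,-1]$;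 $-\frac1{\sqrt\beta}\mathrm{j}$ for $[-1,-1,1,1]$; $\frac1{\sqrt{\alpha\beta}}\mathrm{k}$ for $[1,-1,-1,1]$; $-\frac1{\sqrt{\alpha\beta}}\mathrm{k}$ for $[-1,1,1,-1]$; $a_1$ for $[1,1,1,-1]$; $a_1^{\mathrm{i}}$ for $[1,-1,1,1]$; $a_1^{\mathrm{j}}$ for $[1,1,-1,1]$; $a_1^{\mathrm{k}}$ for $[-1,1,1,1]$; $a_2$ for $[1,-1,-1,-1]$; $a_2^{\mathrm{i}}$ for $[-1,-1,1,-1]$; $a_2^{\mathrm{j}}$ for $[-1,1,-1,-1]$; $a_2^{\mathrm{k}}$ for $[-1,-1,-1,1]$, where the listed vectors are the values of $\boldsymbol\gamma_1$. 2. $\det(\mathbf{X})=\det(\mathbf{P})\prod_{i=1}^p u_{i,i}$, where $u_{i,i}$ is the $(i,i)$ entry of $\mathbf{U}$.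
   Context: $\mathbb{T}_{\alpha\beta}$ (the $(\alpha\beta)$-tessarines) is the commutative, associative real algebra with basis $1,\mathrm{i},\mathrm{j},\mathrm{k}$ and multiplication $\mathrm{i}^2=\alpha$, $\mathrm{j}^2=\beta$, $\mathrm{k}^2=\alpha\beta$, $\mathrm{i}\mathrm{j}=\mathrm{k}$, $\mathrm{i}\mathrm{k}=\alpha\mathrm{j}$, $\mathrm{j}\mathrm{k}=\beta\mathrm{i}$. $\mathbb{C}_\alpha=\{a+b\mathrm{i}\}$. For $x=a+b\mathrm{i}+c\mathrm{j}+d\mathrm{k}$: $x^{\mathrm{i}}=a+b\mathrm{i}-c\mathrm{j}-d\mathrm{k}$, $x^{\mathrm{j}}=a-b\mathrm{i}+c\mathrm{j}-d\mathrm{k}$, $x^{\mathrm{k}}=a-b\mathrm{i}-c\mathrm{j}+d\mathrm{k}$. The determinant over $\mathbb{T}_{\alpha\beta}$ is the usual one, $\det(\mathbf{X})=\sum_{\tau}\mathrm{sgn}(\tau)\prod_i x_{i,\tau(i)}$. Write $\mathbf{X}=\mathbf{A}+\mathbf{B}\mathrm{i}+\mathbf{C}\mathrm{j}+\mathbf{D}\mathrm{k}$ with real $\mathbf{A},\mathbf{B},\mathbf{C},\mathbf{D}$, and put $\mathbf{X}_a=\mathbf{A}+\mathbf{B}\mathrm{i}$, $\mathbf{X}_b=\mathbf{C}+\mathbf{D}\mathrm{i}$, $\mathbf{X}_s=\mathbf{X}_a+\sqrt\beta\,\mathbf{X}_b$, $\mathbf{X}_d=\mathbf{X}_a-\sqrt\beta\,\mathbf{X}_b$.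 For a real or complex square matrix $\mathbf{Z}$, the LU factorization with partial pivoting is $\mathbf{P}\mathbf{Z}=\mathbf{L}\mathbf{U}$ with $\mathbf{P}$ a permutation matrix, and $\mathbf{L}$ and $\mathbf{U}$ the lower and upper triangular matrices, respectively. The signature of a permutation matrix is the sign of the corresponding permutation. Construction for $(\alpha)$-complex $\mathbf{Z}=\mathbf{M}+\mathbf{N}\mathrm{i}$ ($\mathbf{M},\mathbf{N}$ real): (i) if $\alpha<0$, take the LU factorization with partial pivoting $(\dot{\mathbf{P}},\mathbf{L}_1+\mathbf{L}_2\epsilon,\mathbf{U}_1+\mathbf{U}_2\epsilon)$ of the complex matrix $\mathbf{M}+\sqrt{|\alpha|}\,\mathbf{N}\epsilon$ ($\epsilon^2=-1$) and use $(\dot{\mathbf{P}},\mathbf{L}_1+\frac{\mathbf{L}_2}{\sqrt{|\alpha|}}\mathrm{i},\mathbf{U}_1+\frac{\mathbf{U}_2}{\sqrt{|\alpha|}}\mathrm{i})$; (ii) if $\alpha>0$, take the real LU factorizations with partial pivoting $(\mathbf{P}_+,\mathbf{L}_+,\mathbf{U}_+)$ of $\mathbf{M}+\sqrt\alpha\,\mathbf{N}$ and $(\mathbf{P}_-,\mathbf{L}_-,\mathbf{U}_-)$ of $\mathbf{M}-\sqrt\alpha\,\mathbf{N}$, and use $\frac{\mathbf{Y}_++\mathbf{Y}_-}{2}+\frac{\mathbf{Y}_+-\mathbf{Y}_-}{2\sqrt\alpha}\mathrm{i}$ for $\mathbf{Y}=\mathbf{P},\mathbf{L},\mathbf{U}$.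 Apply this to $\mathbf{X}_s$ and $\mathbf{X}_d$, obtaining $(\mathbf{P}_s,\mathbf{L}_s,\mathbf{U}_s)$ and $(\mathbf{P}_d,\mathbf{L}_d,\mathbf{U}_d)$, and set $\mathbf{Y}=\frac{\mathbf{Y}_s+\mathbf{Y}_d}{2}+\frac{\mathbf{Y}_s-\mathbf{Y}_d}{2\sqrt\beta}\mathrm{j}$ for $\mathbf{Y}=\mathbf{P},\mathbf{L},\mathbf{U}$; then $\mathbf{P}\mathbf{X}=\mathbf{L}\mathbf{U}$. Signatures: if $\alpha<0$, $\mathbf{P}_s,\mathbf{P}_d$ are real permutation matrices and $\gamma_s,\gamma_d$ are their signatures. If $\alpha>0$, $\gamma_{s1},\gamma_{d1}$ are the signatures of the permutation matrices $\mathbf{P}_+,\mathbf{P}_-$ used for $\mathbf{X}_s$, and $\gamma_{s2},\gamma_{d2}$ those of $\mathbf{P}_+,\mathbf{P}_-$ used for $\mathbf{X}_d$. *)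

theory Defs
  imports
    "HOL-Analysis.Analysis"
    "HOL-Combinatorics.Permutations"
    "HOL-Algebra.Ring"
    "Jordan_Normal_Form.Matrix"
begin

text \<open>
  The underlying real vector space of the tessarines does not depend on \<open>\<alpha>\<close> and \<open>\<beta>\<close>;
  only the multiplication does. As \<open>\<alpha>\<close> and \<open>\<beta>\<close> are arbitrary reals, the algebra is a
  HOL-Algebra ring depending on them rather than a type class instance.
\<close>

datatype tess = Tess (t1: real) (ti: real) (tj: real) (tk: real)

instantiation tess :: "{real_vector, one}"
begin

definition "0 = Tess 0 0 0 0"
definition "1 = Tess 1 0 0 0"
definition "x + y = Tess (t1 x + t1 y) (ti x + ti y) (tj x + tj y) (tk x + tk y)"
definition "x - y = Tess (t1 x - t1 y) (ti x - ti y) (tj x - tj y) (tk x - tk y)"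
definition "- x = Tess (- t1 x) (- ti x) (- tj x) (- tk x)"
definition "r *\<^sub>R x = Tess (r * t1 x) (r * ti x) (r * tj x) (r * tk x)"

instance
  by intro_classes
    (simp_all add: zero_tess_def plus_tess_def minus_tess_def uminus_tess_def scaleR_tess_def
      algebra_simps)

end

definition unit_i :: tess where "unit_i = Tess 0 1 0 0"
definition unit_j :: tess where "unit_j = Tess 0 0 1 0"
definition unit_k :: tess where "unit_k = Tess 0 0 0 1"

definition tess_mult :: "real \<Rightarrow> real \<Rightarrow> tess \<Rightarrow> tess \<Rightarrow> tess" where
  "tess_mult \<alpha> \<beta> x y = Tess
     (t1 x * t1 y + \<alpha> * ti x * ti y + \<beta> * tj x * tj y + \<alpha> * \<beta> * tk x * tk y)
     (t1 x * ti y + ti x * t1 y + \<beta> * (tj x * tk y + tk x * tj y))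
     (t1 x * tj y + tj x * t1 y + \<alpha> * (ti x * tk y + tk x * ti y))
     (t1 x * tk y + tk x * t1 y + ti x * tj y + tj x * ti y)"

lemma tess_mult_units:
  "tess_mult \<alpha> \<beta> unit_i unit_i = \<alpha> *\<^sub>R 1"
  "tess_mult \<alpha> \<beta> unit_j unit_j = \<beta> *\<^sub>R 1"
  "tess_mult \<alpha> \<beta> unit_k unit_k = (\<alpha> * \<beta>) *\<^sub>R 1"
  "tess_mult \<alpha> \<beta> unit_i unit_j = unit_k"
  "tess_mult \<alpha> \<beta> unit_i unit_k = \<alpha> *\<^sub>R unit_j"
  "tess_mult \<alpha> \<beta> unit_j unit_k = \<beta> *\<^sub>R unit_i"
  by (simp_all add: tess_mult_def unit_i_def unit_j_def unit_k_def scaleR_tess_def one_tess_def)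

definition tess_ring :: "real \<Rightarrow> real \<Rightarrow> tess ring" where
  "tess_ring \<alpha> \<beta> =
     \<lparr>carrier = UNIV, monoid.mult = tess_mult \<alpha> \<beta>, one = 1, zero = 0, add = (+)\<rparr>"

lemma cring_tess_ring: "cring (tess_ring \<alpha> \<beta>)"
proof (rule cringI)
  have "\<exists>y. y + x = 0 \<and> x + y = 0" for x :: tess
    by (rule exI[of _ "- x"]) simp
  then show "abelian_group (tess_ring \<alpha> \<beta>)"
    by (intro abelian_groupI)
      (auto simp: tess_ring_def add.assoc add.commute)
  show "Group.comm_monoid (tess_ring \<alpha> \<beta>)"
    by (rule comm_monoidI)
      (auto simp: tess_ring_def tess_mult_def one_tess_def algebra_simps)
qed (simp add: tess_ring_def tess_mult_def plus_tess_def algebra_simps)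

definition conj_i :: "tess \<Rightarrow> tess" where
  "conj_i x = Tess (t1 x) (ti x) (- tj x) (- tk x)"
definition conj_j :: "tess \<Rightarrow> tess" where
  "conj_j x = Tess (t1 x) (- ti x) (tj x) (- tk x)"
definition conj_k :: "tess \<Rightarrow> tess" where
  "conj_k x = Tess (t1 x) (- ti x) (- tj x) (tk x)"

definition det_over :: "('a, 'b) ring_scheme \<Rightarrow> 'a mat \<Rightarrow> 'a" where
  "det_over R X = (\<Oplus>\<^bsub>R\<^esub>\<tau>\<in>{\<tau>. \<tau> permutes {0..<dim_row X}}.
     [sign \<tau>] \<cdot>\<^bsub>R\<^esub> (\<Otimes>\<^bsub>R\<^esub>i\<in>{0..<dim_row X}. X $$ (i, \<tau> i)))"

definition perm_mat :: "nat \<Rightarrow> (nat \<Rightarrow> nat) \<Rightarrow> real mat" where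
  "perm_mat n \<sigma> = mat n n (\<lambda>(i, j). if j = \<sigma> i then 1 else 0)"

definition is_perm_mat :: "nat \<Rightarrow> real mat \<Rightarrow> bool" where
  "is_perm_mat n P \<longleftrightarrow> (\<exists>\<sigma>. \<sigma> permutes {0..<n} \<and> P = perm_mat n \<sigma>)"

definition signature :: "real mat \<Rightarrow> int" where
  "signature P = sign (THE \<sigma>. \<sigma> permutes {0..<dim_row P} \<and> P = perm_mat (dim_row P) \<sigma>)"

definition unit_lower_triangular :: "'a::{zero,one} mat \<Rightarrow> bool" where
  "unit_lower_triangular L \<longleftrightarrow>
     (\<forall>i<dim_row L. L $$ (i, i) = 1 \<and> (\<forall>j<dim_col L. i < j \<longrightarrow> L $$ (i, j) = 0))"

text \<open>
  LU factorization with partial pivoting of a real or complex \<open>n \<times> n\<close> matrix, with the usual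
  normalization that \<open>L\<close> has unit diagonal. It is a relation because ties between pivots of equal
  modulus may be broken arbitrarily. The subtracted sums in the last conjunct are what the first
  \<open>k\<close> elimination steps remove from column \<open>k\<close>; so that conjunct says that the \<open>k\<close>-th pivot has
  maximal modulus among the entries of the reduced matrix on or below the diagonal in column \<open>k\<close>.
\<close>

definition lu_partial_pivoting ::
    "'a::real_normed_field mat \<Rightarrow> real mat \<Rightarrow> 'a mat \<Rightarrow> 'a mat \<Rightarrow> bool" where
  "lu_partial_pivoting Z P L U \<longleftrightarrow>
     (let n = dim_row Z; PZ = map_mat of_real P * Z in
        Z \<in> carrier_mat n n \<and> L \<in> carrier_mat n n \<and> U \<in> carrier_mat n n \<and>
        is_perm_mat n P \<and> unit_lower_triangular L \<and> upper_triangular U \<and>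
        PZ = L * U \<and>
        (\<forall>k<n. \<forall>i\<in>{k..<n}.
           norm (PZ $$ (i, k) - (\<Sum>j<k. L $$ (i, j) * U $$ (j, k)))
           \<le> norm (PZ $$ (k, k) - (\<Sum>j<k. L $$ (k, j) * U $$ (j, k)))))"

text \<open>
  The \<open>\<alpha>\<close>-complex numbers are the tessarines of the form \<open>Tess a b 0 0\<close>. The last argument of
  the next two relations is the list of signatures.
\<close>

definition combine_i :: "real \<Rightarrow> real mat \<Rightarrow> real mat \<Rightarrow> tess mat" where
  "combine_i \<alpha> Yp Ym = mat (dim_row Yp) (dim_col Yp) (\<lambda>ij.
     Tess ((Yp $$ ij + Ym $$ ij) / 2) ((Yp $$ ij - Ym $$ ij) / (2 * sqrt \<alpha>)) 0 0)"

inductive alpha_complex_lu ::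
    "real \<Rightarrow> tess mat \<Rightarrow> tess mat \<Rightarrow> tess mat \<Rightarrow> tess mat \<Rightarrow> int list \<Rightarrow> bool"
  for \<alpha> :: real and Z :: "tess mat"
where
  negative:
    "alpha_complex_lu \<alpha> Z
       (map_mat (\<lambda>r. Tess r 0 0 0) P)
       (map_mat (\<lambda>z. Tess (Re z) (Im z / sqrt \<bar>\<alpha>\<bar>) 0 0) L)
       (map_mat (\<lambda>z. Tess (Re z) (Im z / sqrt \<bar>\<alpha>\<bar>) 0 0) U)
       [signature P]"
  if "\<alpha> < 0"
    and "lu_partial_pivoting (map_mat (\<lambda>z. Complex (t1 z) (sqrt \<bar>\<alpha>\<bar> * ti z)) Z) P L U"
| positive:
    "alpha_complex_lu \<alpha> Z
       (combine_i \<alpha> Pp Pm) (combine_i \<alpha> Lp Lm) (combine_i \<alpha> Up Um)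
       [signature Pp, signature Pm]"
  if "\<alpha> > 0"
    and "lu_partial_pivoting (map_mat (\<lambda>z. t1 z + sqrt \<alpha> * ti z) Z) Pp Lp Up"
    and "lu_partial_pivoting (map_mat (\<lambda>z. t1 z - sqrt \<alpha> * ti z) Z) Pm Lm Um"

definition part_a :: "tess \<Rightarrow> tess" where "part_a x = Tess (t1 x) (ti x) 0 0"
definition part_b :: "tess \<Rightarrow> tess" where "part_b x = Tess (tj x) (tk x) 0 0"

definition combine_j :: "real \<Rightarrow> real \<Rightarrow> tess mat \<Rightarrow> tess mat \<Rightarrow> tess mat" where
  "combine_j \<alpha> \<beta> Ys Yd = mat (dim_row Ys) (dim_col Ys) (\<lambda>ij.
     (1 / 2) *\<^sub>R (Ys $$ ij + Yd $$ ij) +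
     tess_mult \<alpha> \<beta> ((1 / (2 * sqrt \<beta>)) *\<^sub>R (Ys $$ ij - Yd $$ ij)) unit_j)"

inductive tess_lu ::
    "real \<Rightarrow> real \<Rightarrow> tess mat \<Rightarrow> tess mat \<Rightarrow> tess mat \<Rightarrow> tess mat \<Rightarrow> int list \<Rightarrow> bool"
  for \<alpha> \<beta> :: real and X :: "tess mat"
where
  "tess_lu \<alpha> \<beta> X
     (combine_j \<alpha> \<beta> Ps Pd) (combine_j \<alpha> \<beta> Ls Ld) (combine_j \<alpha> \<beta> Us Ud) (\<gamma>s @ \<gamma>d)"
  if "alpha_complex_lu \<alpha> (map_mat (\<lambda>x. part_a x + sqrt \<beta> *\<^sub>R part_b x) X) Ps Ls Us \<gamma>s"
    and "alpha_complex_lu \<alpha> (map_mat (\<lambda>x. part_a x - sqrt \<beta> *\<^sub>R part_b x) X) Pd Ld Ud \<gamma>d"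

definition a1 :: "real \<Rightarrow> real \<Rightarrow> tess" where
  "a1 \<alpha> \<beta> = (1 / 2) *\<^sub>R (1 + (1 / sqrt \<alpha>) *\<^sub>R unit_i + (1 / sqrt \<beta>) *\<^sub>R unit_j
     - (1 / sqrt (\<alpha> * \<beta>)) *\<^sub>R unit_k)"

definition a2 :: "real \<Rightarrow> real \<Rightarrow> tess" where
  "a2 \<alpha> \<beta> = (1 / 2) *\<^sub>R (- 1 + (1 / sqrt \<alpha>) *\<^sub>R unit_i + (1 / sqrt \<beta>) *\<^sub>R unit_j
     + (1 / sqrt (\<alpha> * \<beta>)) *\<^sub>R unit_k)"

end

theory Submission
  imports Defs "Jordan_Normal_Form.Determinant"
begin

text \<open>
  Choosing square roots \<open>r\<close> of \<open>\<alpha>\<close> and \<open>s\<close> of \<open>\<beta>\<close> in \<open>\<real>\<close> or \<open>\<complex>\<close> gives a ring homomorphism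
  \<open>unit_i \<mapsto> r\<close>, \<open>unit_j \<mapsto> s\<close> into a field. It commutes with determinants, and it sends the combined
  factorization to one of the real or complex factorizations it was combined from, where the
  claims are classical. The homomorphisms for all sign choices of \<open>s\<close> (and of \<open>r\<close>, if \<open>\<alpha> > 0\<close>)
  are jointly injective.
\<close>

section \<open>Evaluation homomorphisms and determinants\<close>

definition tess_eval :: "'a \<Rightarrow> 'a \<Rightarrow> tess \<Rightarrow> 'a::real_normed_field" where
  "tess_eval r s x =
     of_real (t1 x) + of_real (ti x) * r + of_real (tj x) * s + of_real (tk x) * (r * s)"

lemma tess_eval_simps [simp]:
  "tess_eval r s 1 = 1"
  "tess_eval r s (x + y) = tess_eval r s x + tess_eval r s y"
  "tess_eval r s (- x) = - tess_eval r s x"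
  "tess_eval r s (x - y) = tess_eval r s x - tess_eval r s y"
  "tess_eval r s (c *\<^sub>R x) = of_real c * tess_eval r s x"
  "tess_eval r s unit_i = r"
  "tess_eval r s unit_j = s"
  "tess_eval r s unit_k = r * s"
  by (simp_all add: tess_eval_def one_tess_def plus_tess_def uminus_tess_def
      minus_tess_def scaleR_tess_def unit_i_def unit_j_def unit_k_def algebra_simps)

text \<open>Each conjugation negates two of the three units, which amounts to negating
  \<open>s\<close>, \<open>r\<close> or both. So conjugating \<open>a1\<close> or \<open>a2\<close>
  only permutes its values at the four sign choices.\<close>

lemma tess_eval_conj [simp]:
  "tess_eval r s (conj_i x) = tess_eval r (- s) x"
  "tess_eval r s (conj_j x) = tess_eval (- r) s x"
  "tess_eval r s (conj_k x) = tess_eval (- r) (- s) x"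
  by (simp_all add: tess_eval_def conj_i_def conj_j_def conj_k_def)

text \<open>Only the squares of \<open>r\<close> and \<open>s\<close> are prescribed, so one locale
  serves every sign choice. The field stays open because a negative \<alpha> has its square roots
  only in the complex numbers.\<close>

locale tess_roots =
  fixes \<alpha> \<beta> :: real and r s :: "'a::real_normed_field"
  assumes r: "r * r = of_real \<alpha>" and s: "s * s = of_real \<beta>"
begin

lemma tess_eval_mult: "tess_eval r s (tess_mult \<alpha> \<beta> x y) = tess_eval r s x * tess_eval r s y"
  unfolding tess_eval_def tess_mult_def
  \<comment> \<open>Writing \<open>r * r\<close> for \<alpha> and \<open>s * s\<close> for \<beta>
    leaves a polynomial identity in the roots and the coordinates.\<close>
  by (simp add: r [symmetric] s [symmetric] algebra_simps)

sublocale R: cring "tess_ring \<alpha> \<beta>"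
  by (rule cring_tess_ring)

lemma carrier_tess [simp]: "x \<in> carrier (tess_ring \<alpha> \<beta>)"
  by (simp add: tess_ring_def)

lemma tess_eval_ring [simp]:
  "tess_eval r s (x \<otimes>\<^bsub>tess_ring \<alpha> \<beta>\<^esub> y) = tess_eval r s x * tess_eval r s y"
  "tess_eval r s (x \<oplus>\<^bsub>tess_ring \<alpha> \<beta>\<^esub> y) = tess_eval r s x + tess_eval r s y"
  "tess_eval r s \<one>\<^bsub>tess_ring \<alpha> \<beta>\<^esub> = 1"
  "tess_eval r s \<zero>\<^bsub>tess_ring \<alpha> \<beta>\<^esub> = 0"
  by (simp_all add: tess_ring_def tess_eval_mult) (simp add: tess_eval_def zero_tess_def)

lemma tess_eval_a_inv [simp]:
  "tess_eval r s (\<ominus>\<^bsub>tess_ring \<alpha> \<beta>\<^esub> x) = - tess_eval r s x"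
proof -
  \<comment> \<open>Negation is not a component of the ring record but the inverse in its additive
    group, so its value is recovered from \<open>R.l_neg\<close>.\<close>
  have "tess_eval r s (\<ominus>\<^bsub>tess_ring \<alpha> \<beta>\<^esub> x \<oplus>\<^bsub>tess_ring \<alpha> \<beta>\<^esub> x) = 0"
    by (simp only: R.l_neg carrier_tess tess_eval_ring)
  then show ?thesis
    by (simp add: eq_neg_iff_add_eq_0)
qed

lemma tess_eval_finprod:
  "finite A \<Longrightarrow>
    tess_eval r s (\<Otimes>\<^bsub>tess_ring \<alpha> \<beta>\<^esub>i\<in>A. f i) = (\<Prod>i\<in>A. tess_eval r s (f i))"
  by (induction A rule: finite_induct) (simp_all add: Pi_def)

lemma tess_eval_finsum:
  "finite A \<Longrightarrow>
    tess_eval r s (\<Oplus>\<^bsub>tess_ring \<alpha> \<beta>\<^esub>i\<in>A. f i) = (\<Sum>i\<in>A. tess_eval r s (f i))"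
  by (induction A rule: finite_induct) (simp_all add: Pi_def R.finsum_insert)

text \<open>The signs in \<open>det_over\<close> act as integer multiples in the additive group of
  the ring; only the multiples by 1 and -1 occur.\<close>

lemma tess_eval_add_pow_sign:
  "tess_eval r s ([sign \<tau>] \<cdot>\<^bsub>tess_ring \<alpha> \<beta>\<^esub> x) = signof \<tau> * tess_eval r s x"
proof -
  have "[(-1::int)] \<cdot>\<^bsub>tess_ring \<alpha> \<beta>\<^esub> x = \<ominus>\<^bsub>tess_ring \<alpha> \<beta>\<^esub> ([(1::int)] \<cdot>\<^bsub>tess_ring \<alpha> \<beta>\<^esub> x)"
    by (rule R.add.int_pow_neg) simp
  moreover have "[(1::int)] \<cdot>\<^bsub>tess_ring \<alpha> \<beta>\<^esub> x = x"
    by (rule R.add.int_pow_1) simp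
  ultimately show ?thesis
    by (simp add: sign_def)
qed

text \<open>A ring homomorphism can be applied term by term to the Leibniz formula, which
  \<open>det_over\<close> and \<open>det\<close> share.\<close>

lemma tess_eval_det:
  assumes "Y \<in> carrier_mat n n"
  shows "tess_eval r s (det_over (tess_ring \<alpha> \<beta>) Y) = det (map_mat (tess_eval r s) Y)"
proof -
  have "map_mat (tess_eval r s) Y $$ (i, \<tau> i) = tess_eval r s (Y $$ (i, \<tau> i))"
    if "\<tau> permutes {0..<n}" "i < n" for \<tau> i
    using that assms permutes_in_image[of \<tau> "{0..<n}" i] by auto
  then show ?thesis
    using assms
    by (auto simp: det_over_def det_def tess_eval_finsum tess_eval_finprod tess_eval_add_pow_sign
        finite_permutations intro!: sum.cong prod.cong)
qed

end

section \<open>Permutation matrices, their signatures and determinants\<close>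

text \<open>Row \<open>i\<close> has its only 1 in column \<open>\<sigma> i\<close>, and outside the
  index range both permutations are the identity. This uniqueness makes the \<open>THE\<close> in
  \<open>signature\<close> meaningful.\<close>

lemma perm_mat_inj:
  assumes "\<sigma> permutes {0..<n}" "\<tau> permutes {0..<n}" "perm_mat n \<sigma> = perm_mat n \<tau>"
  shows "\<sigma> = \<tau>"
proof
  fix i
  show "\<sigma> i = \<tau> i"
  proof (cases "i < n")
    case True
    then have "\<sigma> i < n"
      using permutes_in_image[OF assms(1), of i] by simp
    then have "perm_mat n \<sigma> $$ (i, \<sigma> i) = 1"
      and "perm_mat n \<tau> $$ (i, \<sigma> i) = (if \<sigma> i = \<tau> i then 1 else 0)"
      using True by (auto simp: perm_mat_def)
    then show ?thesis
      using assms(3) by (metis zero_neq_one)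
  next
    case False
    then show ?thesis
      using permutes_not_in[OF assms(1)] permutes_not_in[OF assms(2)] by simp
  qed
qed

lemma signature_perm_mat:
  assumes "\<sigma> permutes {0..<n}"
  shows "signature (perm_mat n \<sigma>) = sign \<sigma>"
proof -
  have "(THE \<tau>. \<tau> permutes {0..<n} \<and> perm_mat n \<sigma> = perm_mat n \<tau>) = \<sigma>"
    using assms perm_mat_inj by (intro the_equality) auto
  moreover have "dim_row (perm_mat n \<sigma>) = n"
    by (simp add: perm_mat_def)
  ultimately show ?thesis
    by (simp add: signature_def)
qed

text \<open>In the Leibniz sum every term vanishes except the one with \<tau> = \<sigma>, whose
  product is 1.\<close>

lemma det_perm_mat:
  assumes "\<sigma> permutes {0..<n}"
  shows "det (map_mat of_real (perm_mat n \<sigma>)) = (signof \<sigma> :: 'a::real_normed_field)"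
proof -
  let ?A = "map_mat of_real (perm_mat n \<sigma>) :: 'a mat"
  have A: "?A $$ (i, \<tau> i) = (if \<tau> i = \<sigma> i then 1 else 0)"
    if "\<tau> permutes {0..<n}" "i < n" for \<tau> i
    using that permutes_in_image[OF that(1), of i] by (auto simp: perm_mat_def)
  have "signof \<tau> * (\<Prod>i = 0..<n. ?A $$ (i, \<tau> i)) = (if \<tau> = \<sigma> then signof \<sigma> else 0)"
    if \<tau>: "\<tau> permutes {0..<n}" for \<tau>
  proof (cases "\<tau> = \<sigma>")
    case True
    then show ?thesis
      using A[OF \<tau>] by simp
  next
    case False
    then obtain i where "\<tau> i \<noteq> \<sigma> i"
      by auto
    \<comment> \<open>Both permutations fix all indices from \<open>n\<close> on, so they differ at
      an actual row, and this row contributes a factor 0.\<close>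
    moreover from this have "i < n"
      using permutes_not_in[OF \<tau>, of i] permutes_not_in[OF assms, of i] by fastforce
    ultimately have "(\<Prod>i = 0..<n. ?A $$ (i, \<tau> i)) = 0"
      using A[OF \<tau>] by (intro prod_zero) auto
    then show ?thesis
      using False by simp
  qed
  then have "det ?A = (\<Sum>\<tau> | \<tau> permutes {0..<n}. if \<tau> = \<sigma> then signof \<sigma> else 0)"
    by (subst det_def'[of _ n]) (auto simp: perm_mat_def intro!: sum.cong)
  also have "\<dots> = signof \<sigma>"
    using assms by (simp add: finite_permutations)
  finally show ?thesis .
qed

section \<open>Determinants from one real or complex LU factorization\<close>

lemma prod_list_diag_mat:
  "A \<in> carrier_mat n n \<Longrightarrow> prod_list (diag_mat A) = (\<Prod>i = 0..<n. A $$ (i, i))"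
  by (simp add: diag_mat_def prod.list_conv_set_nth)

text \<open>Take determinants in P Z = L U. The unit diagonal gives \<open>det L = 1\<close>, and
  \<open>det P\<close> is a sign, hence its own inverse, so it can be moved to the other
  side.\<close>

lemma lu_partial_pivoting_det:
  fixes Z :: "'a::real_normed_field mat"
  assumes Z: "Z \<in> carrier_mat n n" and lu: "lu_partial_pivoting Z P L U"
  shows "P \<in> carrier_mat n n" and "U \<in> carrier_mat n n"
    and "signature P \<in> {1, -1}"
    and "det (map_mat of_real P :: 'a mat) = of_int (signature P)"
    and "det Z = of_int (signature P) * (\<Prod>i = 0..<n. U $$ (i, i))"
proof -
  from lu Z have L: "L \<in> carrier_mat n n" and U: "U \<in> carrier_mat n n"
    and P: "is_perm_mat n P" and low: "unit_lower_triangular L" and up: "upper_triangular U"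
    and PZ: "map_mat of_real P * Z = L * U"
    by (auto simp: lu_partial_pivoting_def Let_def)
  from P obtain \<sigma> where \<sigma>: "\<sigma> permutes {0..<n}" and P_eq: "P = perm_mat n \<sigma>"
    by (auto simp: is_perm_mat_def)
  show Pc: "P \<in> carrier_mat n n"
    by (simp add: P_eq perm_mat_def)
  show "U \<in> carrier_mat n n"
    by (fact U)
  have sig: "signature P = sign \<sigma>"
    by (simp add: P_eq signature_perm_mat \<sigma>)
  then show "signature P \<in> {1, -1}"
    by (auto simp: sign_def)
  show detP: "det (map_mat of_real P :: 'a mat) = of_int (signature P)"
    using det_perm_mat[OF \<sigma>] by (simp add: P_eq sig[unfolded P_eq])
  have "det L = prod_list (diag_mat L)"
    using low L by (intro det_lower_triangular) (auto simp: unit_lower_triangular_def)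
  also have "\<dots> = 1"
    using low L by (simp add: prod_list_diag_mat unit_lower_triangular_def)
  finally have detL: "det L = 1" .
  have "det (map_mat of_real P :: 'a mat) * det Z = det L * det U"
    using PZ det_mult[of "map_mat of_real P" n Z] det_mult[of L n U] Pc Z L U by simp
  then have PZ_det: "of_int (signature P) * det Z = (\<Prod>i = 0..<n. U $$ (i, i))"
    using det_upper_triangular[OF up U] prod_list_diag_mat[OF U] unfolding detP detL by simp
  have "det Z = of_int (signature P) * (of_int (signature P) * det Z)"
    by (simp add: sig sign_def)
  then show "det Z = of_int (signature P) * (\<Prod>i = 0..<n. U $$ (i, i))"
    unfolding PZ_det .
qed

section \<open>Factorizations seen through an evaluation\<close>

text \<open>Keeps exactly the consequences of a factorization that the determinant claims require,
  with \<open>det L = 1\<close> already absorbed. In this form they pass from the parts X_s and X_d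
  to X.\<close>

definition lu_det :: "'a::real_normed_field \<Rightarrow> 'a \<Rightarrow> nat \<Rightarrow> int \<Rightarrow> tess mat \<Rightarrow> tess mat \<Rightarrow> tess mat \<Rightarrow> bool"
  where "lu_det r s p g Z P U \<longleftrightarrow>
    P \<in> carrier_mat p p \<and> U \<in> carrier_mat p p \<and> g \<in> {1, -1} \<and>
    det (map_mat (tess_eval r s) P) = of_int g \<and>
    det (map_mat (tess_eval r s) Z) = of_int g * (\<Prod>i = 0..<p. tess_eval r s (U $$ (i, i)))"

lemma lu_detI:
  fixes r s :: "'a::real_normed_field"
  assumes lu: "lu_partial_pivoting (map_mat (tess_eval r s) Z) P' L' U'"
    and Z: "Z \<in> carrier_mat p p"
    and P: "P \<in> carrier_mat p p" "map_mat (tess_eval r s) P = map_mat of_real P'"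
    and U: "U \<in> carrier_mat p p" "map_mat (tess_eval r s) U = U'"
  shows "lu_det r s p (signature P') Z P U"
proof -
  have "map_mat (tess_eval r s) Z \<in> carrier_mat p p"
    using Z by simp
  note det = lu_partial_pivoting_det[OF this lu]
  have "U' $$ (i, i) = tess_eval r s (U $$ (i, i))" if "i < p" for i
    using U that by auto
  then show ?thesis
    using det P U by (simp add: lu_det_def)
qed

text \<open>Apart from sizes, \<open>lu_det\<close> depends on its matrices only through their
  evaluated images.\<close>

lemma lu_det_cong:
  assumes "Z' \<in> carrier_mat p p" "P' \<in> carrier_mat p p" "U' \<in> carrier_mat p p"
    and "map_mat (tess_eval r s) Z = map_mat (tess_eval r' s') Z'"
    and "map_mat (tess_eval r s) P = map_mat (tess_eval r' s') P'"
    and "map_mat (tess_eval r s) U = map_mat (tess_eval r' s') U'"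
    and "lu_det r s p g Z P U"
  shows "lu_det r' s' p g Z' P' U'"
proof -
  have U: "U \<in> carrier_mat p p"
    using assms(7) by (simp add: lu_det_def)
  have "tess_eval r s (U $$ (i, i)) = tess_eval r' s' (U' $$ (i, i))" if "i < p" for i
    using arg_cong[OF assms(6), of "\<lambda>M. M $$ (i, i)"] that U assms(3) by simp
  then show ?thesis
    using assms by (simp add: lu_det_def)
qed

text \<open>A vanishing \<open>part_b\<close> characterizes the \<alpha>-complex numbers; their
  values do not involve \<open>s\<close>.\<close>

lemma tess_eval_part_b_eq_0:
  "part_b z = 0 \<Longrightarrow> tess_eval r s z = of_real (t1 z) + of_real (ti z) * r"
  by (simp add: part_b_def zero_tess_def tess_eval_def)

section \<open>The construction for \<alpha>-complex matrices\<close>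

text \<open>Evaluating at the imaginary root of \<alpha> turns Z into the complex matrix that the
  construction factorizes, and undoes the division of the imaginary parts by
  \<open>sqrt \<bar>\<alpha>\<bar>\<close>. All entries are \<alpha>-complex, so \<open>s\<close>
  may be arbitrary.\<close>

lemma alpha_complex_lu_neg:
  assumes "\<alpha> < 0" and lu: "alpha_complex_lu \<alpha> Z P L U \<gamma>"
    and Z: "Z \<in> carrier_mat p p"
    and Z_alpha: "\<And>i j. i < p \<Longrightarrow> j < p \<Longrightarrow> part_b (Z $$ (i, j)) = 0"
  obtains g where "\<gamma> = [g]" and "\<And>s. lu_det (Complex 0 (sqrt \<bar>\<alpha>\<bar>)) s p g Z P U"
  using lu
proof cases
  case (negative P' L' U')
  have "lu_det (Complex 0 (sqrt \<bar>\<alpha>\<bar>)) s p (signature P') Z P U" for s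
  proof (rule lu_detI)
    have "map_mat (tess_eval (Complex 0 (sqrt \<bar>\<alpha>\<bar>)) s) Z
        = map_mat (\<lambda>z. Complex (t1 z) (sqrt \<bar>\<alpha>\<bar> * ti z)) Z"
      using Z by (intro eq_matI)
        (auto simp: tess_eval_part_b_eq_0[OF Z_alpha] complex_eq_iff)
    then show "lu_partial_pivoting (map_mat (tess_eval (Complex 0 (sqrt \<bar>\<alpha>\<bar>)) s) Z) P' L' U'"
      using negative by simp
    have "map_mat (\<lambda>z. Complex (t1 z) (sqrt \<bar>\<alpha>\<bar> * ti z)) Z \<in> carrier_mat p p"
      using Z by simp
    note carriers = lu_partial_pivoting_det(1,2)[OF this negative(6)]
    then show "P \<in> carrier_mat p p" "U \<in> carrier_mat p p"
      using negative by auto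
    show "map_mat (tess_eval (Complex 0 (sqrt \<bar>\<alpha>\<bar>)) s) P = map_mat of_real P'"
      using negative by (intro eq_matI) (auto simp: tess_eval_def)
    show "map_mat (tess_eval (Complex 0 (sqrt \<bar>\<alpha>\<bar>)) s) U = U'"
      using negative by (intro eq_matI) (auto simp: tess_eval_def complex_eq_iff)
  qed (fact Z)
  then show ?thesis
    using negative that by blast
qed (use assms(1) in simp)

text \<open>Evaluating at the two real roots of \<alpha> gives the two real matrices that are
  factorized, and recovers from \<open>combine_i\<close> its first and second argument,
  respectively.\<close>

lemma alpha_complex_lu_pos:
  assumes "\<alpha> > 0" and lu: "alpha_complex_lu \<alpha> Z P L U \<gamma>"
    and Z: "Z \<in> carrier_mat p p"
    and Z_alpha: "\<And>i j. i < p \<Longrightarrow> j < p \<Longrightarrow> part_b (Z $$ (i, j)) = 0"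
  obtains g h where "\<gamma> = [g, h]"
    and "\<And>s. lu_det (sqrt \<alpha>) s p g Z P U" and "\<And>s. lu_det (- sqrt \<alpha>) s p h Z P U"
  using lu
proof cases
  case (positive Pp Lp Up Pm Lm Um)
  have eval_Z: "map_mat (tess_eval (sqrt \<alpha>) s) Z = map_mat (\<lambda>z. t1 z + sqrt \<alpha> * ti z) Z"
    "map_mat (tess_eval (- sqrt \<alpha>) s) Z = map_mat (\<lambda>z. t1 z - sqrt \<alpha> * ti z) Z" for s
    using Z by (auto intro!: eq_matI simp: tess_eval_part_b_eq_0[OF Z_alpha])
  have Z': "map_mat (\<lambda>z. t1 z + sqrt \<alpha> * ti z) Z \<in> carrier_mat p p"
    "map_mat (\<lambda>z. t1 z - sqrt \<alpha> * ti z) Z \<in> carrier_mat p p"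
    using Z by auto
  note carriers = lu_partial_pivoting_det(1,2)[OF Z'(1) positive(6)]
    lu_partial_pivoting_det(1,2)[OF Z'(2) positive(7)]
  have eval_combine: "map_mat (tess_eval (sqrt \<alpha>) s) (combine_i \<alpha> Yp Ym) = Yp"
    "map_mat (tess_eval (- sqrt \<alpha>) s) (combine_i \<alpha> Yp Ym) = Ym"
    if "Yp \<in> carrier_mat p p" "Ym \<in> carrier_mat p p" for Yp Ym s
    using that assms(1)
    by (auto intro!: eq_matI simp: tess_eval_def combine_i_def field_simps)
  have PU: "P \<in> carrier_mat p p" "U \<in> carrier_mat p p"
    using positive carriers by (auto simp: combine_i_def)
  \<comment> \<open>Over the reals, \<open>of_real\<close> simplifies to \<open>id\<close>, so the
    goals from \<open>lu_detI\<close> contain \<open>map_mat id\<close>.\<close>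
  have map_mat_id: "map_mat id Y = Y" for Y :: "real mat"
    by (intro eq_matI) auto
  have "lu_det (sqrt \<alpha>) s p (signature Pp) Z P U" for s
    by (rule lu_detI[where U' = Up and L' = Lp])
      (use positive carriers PU Z in \<open>simp_all add: eval_Z eval_combine map_mat_id\<close>)
  moreover have "lu_det (- sqrt \<alpha>) s p (signature Pm) Z P U" for s
    by (rule lu_detI[where U' = Um and L' = Lm])
      (use positive carriers PU Z in \<open>simp_all add: eval_Z eval_combine map_mat_id\<close>)
  ultimately show ?thesis
    using positive that by blast
qed (use assms(1) in simp)

section \<open>Combining the factorizations of X_s and X_d\<close>

context tess_roots
begin

text \<open>At \<open>s = sqrt \<beta>\<close> the matrix X takes the values of X_s, and the
  combination becomes (Y_s + Y_d)/2 + (Y_s - Y_d)/2 = Y_s.\<close>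

lemma lu_det_combine_j_plus:
  assumes "\<beta> > 0" and s_eq: "s = of_real (sqrt \<beta>)" and X: "X \<in> carrier_mat p p"
    and lu: "lu_det r s p g (map_mat (\<lambda>x. part_a x + sqrt \<beta> *\<^sub>R part_b x) X) Ps Us"
  shows "lu_det r s p g X (combine_j \<alpha> \<beta> Ps Pd) (combine_j \<alpha> \<beta> Us Ud)"
proof -
  have eval_combine: "map_mat (tess_eval r s) (combine_j \<alpha> \<beta> Ys Yd) = map_mat (tess_eval r s) Ys"
    if "Ys \<in> carrier_mat p p" for Ys Yd
    using that assms(1)
    by (auto intro!: eq_matI simp: combine_j_def tess_eval_mult[unfolded s_eq] s_eq)
      (simp add: field_simps)
  have eval_X: "map_mat (tess_eval r s) (map_mat (\<lambda>x. part_a x + sqrt \<beta> *\<^sub>R part_b x) X)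
      = map_mat (tess_eval r s) X"
    by (intro eq_matI) (auto simp: s_eq tess_eval_def part_a_def part_b_def plus_tess_def
        scaleR_tess_def algebra_simps)
  have PU: "Ps \<in> carrier_mat p p" "Us \<in> carrier_mat p p"
    using lu by (auto simp: lu_det_def)
  show ?thesis
    by (rule lu_det_cong[OF X _ _ eval_X _ _ lu])
      (use PU in \<open>auto simp: eval_combine\<close>, auto simp: combine_j_def)
qed

text \<open>The opposite root changes the sign of the second summand, which leaves Y_d and X_d. The
  sizes of \<open>Ps\<close> and \<open>Us\<close> are assumed because \<open>combine_j\<close>
  takes its dimensions from its first argument.\<close>

lemma lu_det_combine_j_minus:
  assumes "\<beta> > 0" and s_eq: "s = - of_real (sqrt \<beta>)" and X: "X \<in> carrier_mat p p"
    and Ps: "Ps \<in> carrier_mat p p" and Us: "Us \<in> carrier_mat p p"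
    and lu: "lu_det r s p g (map_mat (\<lambda>x. part_a x - sqrt \<beta> *\<^sub>R part_b x) X) Pd Ud"
  shows "lu_det r s p g X (combine_j \<alpha> \<beta> Ps Pd) (combine_j \<alpha> \<beta> Us Ud)"
proof -
  have eval_combine: "map_mat (tess_eval r s) (combine_j \<alpha> \<beta> Ys Yd) = map_mat (tess_eval r s) Yd"
    if "Ys \<in> carrier_mat p p" "Yd \<in> carrier_mat p p" for Ys Yd
    using that assms(1)
    by (auto intro!: eq_matI simp: combine_j_def tess_eval_mult[unfolded s_eq] s_eq)
      (simp add: field_simps)
  have eval_X: "map_mat (tess_eval r s) (map_mat (\<lambda>x. part_a x - sqrt \<beta> *\<^sub>R part_b x) X)
      = map_mat (tess_eval r s) X"
    by (intro eq_matI) (auto simp: s_eq tess_eval_def part_a_def part_b_def minus_tess_def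
        scaleR_tess_def algebra_simps)
  have PU: "Pd \<in> carrier_mat p p" "Ud \<in> carrier_mat p p"
    using lu by (auto simp: lu_det_def)
  show ?thesis
    by (rule lu_det_cong[OF X _ _ eval_X _ _ lu])
      (use PU Ps Us in \<open>auto simp: eval_combine\<close>, auto simp: combine_j_def)
qed

text \<open>Both claims of the theorem as seen by one homomorphism: the value of
  \<open>det P\<close> is a known sign, and the product formula holds after evaluation.\<close>

lemma lu_det_tess_eval:
  assumes "X \<in> carrier_mat p p" and "lu_det r s p g X P U"
  shows "tess_eval r s (det_over (tess_ring \<alpha> \<beta>) P) = of_int g"
    and "tess_eval r s (det_over (tess_ring \<alpha> \<beta>) X) =
      tess_eval r s (det_over (tess_ring \<alpha> \<beta>) P \<otimes>\<^bsub>tess_ring \<alpha> \<beta>\<^esub>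
        (\<Otimes>\<^bsub>tess_ring \<alpha> \<beta>\<^esub>i\<in>{0..<p}. U $$ (i, i)))"
  using assms by (auto simp: lu_det_def tess_eval_det[of _ p] tess_eval_finprod)

end

lemma tess_lu_neg:
  assumes "\<alpha> < 0" and "\<beta> > 0" and X: "X \<in> carrier_mat p p" and lu: "tess_lu \<alpha> \<beta> X P L U \<gamma>"
  obtains g h where "\<gamma> = [g, h]"
    and "lu_det (Complex 0 (sqrt \<bar>\<alpha>\<bar>)) (of_real (sqrt \<beta>)) p g X P U"
    and "lu_det (Complex 0 (sqrt \<bar>\<alpha>\<bar>)) (- of_real (sqrt \<beta>)) p h X P U"
  using lu
proof cases
  case (1 Ps Ls Us \<gamma>s Pd Ld Ud \<gamma>d)
  let ?r = "Complex 0 (sqrt \<bar>\<alpha>\<bar>)"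
  have r: "?r * ?r = of_real \<alpha>"
    using assms(1) by (simp add: complex_eq_iff)
  interpret plus: tess_roots \<alpha> \<beta> ?r "of_real (sqrt \<beta>)"
    using r assms(2) by unfold_locales (auto simp flip: of_real_mult)
  interpret minus: tess_roots \<alpha> \<beta> ?r "- of_real (sqrt \<beta>)"
    using r assms(2) by unfold_locales (auto simp flip: of_real_mult)
  obtain g where g: "\<gamma>s = [g]"
    "\<And>s. lu_det ?r s p g (map_mat (\<lambda>x. part_a x + sqrt \<beta> *\<^sub>R part_b x) X) Ps Us"
    by (rule alpha_complex_lu_neg[OF assms(1) 1(5), of p])
      (use X in \<open>auto simp: part_a_def part_b_def plus_tess_def scaleR_tess_def zero_tess_def\<close>)
  obtain h where h: "\<gamma>d = [h]"
    "\<And>s. lu_det ?r s p h (map_mat (\<lambda>x. part_a x - sqrt \<beta> *\<^sub>R part_b x) X) Pd Ud"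
    by (rule alpha_complex_lu_neg[OF assms(1) 1(6), of p])
      (use X in \<open>auto simp: part_a_def part_b_def minus_tess_def scaleR_tess_def zero_tess_def\<close>)
  have "Ps \<in> carrier_mat p p" "Us \<in> carrier_mat p p"
    using g(2) by (auto simp: lu_det_def)
  then show ?thesis
    using that[of g h] 1 g(1) h(1) plus.lu_det_combine_j_plus[OF assms(2) refl X g(2)]
      minus.lu_det_combine_j_minus[OF assms(2) refl X _ _ h(2)]
    by simp
qed

text \<open>Fixes the order of the signatures: they belong to the signs (+,+), (-,+), (+,-), (-,-)
  of the roots of \<alpha> and \<beta>. The first sign comes from \<open>combine_i\<close>, the
  second from \<open>combine_j\<close>.\<close>

lemma tess_lu_pos:
  assumes "\<alpha> > 0" and "\<beta> > 0" and X: "X \<in> carrier_mat p p" and lu: "tess_lu \<alpha> \<beta> X P L U \<gamma>"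
  obtains g1 g2 h1 h2 where "\<gamma> = [g1, g2, h1, h2]"
    and "lu_det (sqrt \<alpha>) (sqrt \<beta>) p g1 X P U"
    and "lu_det (- sqrt \<alpha>) (sqrt \<beta>) p g2 X P U"
    and "lu_det (sqrt \<alpha>) (- sqrt \<beta>) p h1 X P U"
    and "lu_det (- sqrt \<alpha>) (- sqrt \<beta>) p h2 X P U"
  using lu
proof cases
  case (1 Ps Ls Us \<gamma>s Pd Ld Ud \<gamma>d)
  have roots: "tess_roots \<alpha> \<beta> (sqrt \<alpha>) (sqrt \<beta>)" "tess_roots \<alpha> \<beta> (- sqrt \<alpha>) (sqrt \<beta>)"
    "tess_roots \<alpha> \<beta> (sqrt \<alpha>) (- sqrt \<beta>)" "tess_roots \<alpha> \<beta> (- sqrt \<alpha>) (- sqrt \<beta>)"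
    using assms(1,2) by unfold_locales auto
  obtain g1 g2 where g: "\<gamma>s = [g1, g2]"
    "\<And>s. lu_det (sqrt \<alpha>) s p g1 (map_mat (\<lambda>x. part_a x + sqrt \<beta> *\<^sub>R part_b x) X) Ps Us"
    "\<And>s. lu_det (- sqrt \<alpha>) s p g2 (map_mat (\<lambda>x. part_a x + sqrt \<beta> *\<^sub>R part_b x) X) Ps Us"
    by (rule alpha_complex_lu_pos[OF assms(1) 1(5), of p])
      (use X in \<open>auto simp: part_a_def part_b_def plus_tess_def scaleR_tess_def zero_tess_def\<close>)
  obtain h1 h2 where h: "\<gamma>d = [h1, h2]"
    "\<And>s. lu_det (sqrt \<alpha>) s p h1 (map_mat (\<lambda>x. part_a x - sqrt \<beta> *\<^sub>R part_b x) X) Pd Ud"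
    "\<And>s. lu_det (- sqrt \<alpha>) s p h2 (map_mat (\<lambda>x. part_a x - sqrt \<beta> *\<^sub>R part_b x) X) Pd Ud"
    by (rule alpha_complex_lu_pos[OF assms(1) 1(6), of p])
      (use X in \<open>auto simp: part_a_def part_b_def minus_tess_def scaleR_tess_def zero_tess_def\<close>)
  have "Ps \<in> carrier_mat p p" "Us \<in> carrier_mat p p"
    using g(2) by (auto simp: lu_det_def)
  then show ?thesis
    using that[of g1 g2 h1 h2] 1 g(1) h(1)
      tess_roots.lu_det_combine_j_plus[OF roots(1) assms(2) _ X g(2)]
      tess_roots.lu_det_combine_j_plus[OF roots(2) assms(2) _ X g(3)]
      tess_roots.lu_det_combine_j_minus[OF roots(3) assms(2) _ X _ _ h(2)]
      tess_roots.lu_det_combine_j_minus[OF roots(4) assms(2) _ X _ _ h(3)]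
    by simp
qed

section \<open>Joint injectivity of the evaluations\<close>

text \<open>Real and imaginary parts of two complex values give four real equations, as many as
  there are coordinates. Sums and differences separate the coordinates, up to nonzero
  factors.\<close>

lemma tess_eqI_neg:
  assumes "\<alpha> < 0" and "\<beta> > 0"
    and "tess_eval (Complex 0 (sqrt \<bar>\<alpha>\<bar>)) (of_real (sqrt \<beta>)) x =
      tess_eval (Complex 0 (sqrt \<bar>\<alpha>\<bar>)) (of_real (sqrt \<beta>)) y"
    and "tess_eval (Complex 0 (sqrt \<bar>\<alpha>\<bar>)) (- of_real (sqrt \<beta>)) x =
      tess_eval (Complex 0 (sqrt \<bar>\<alpha>\<bar>)) (- of_real (sqrt \<beta>)) y"
  shows "x = y"
proof -
  define a b where "a = sqrt \<bar>\<alpha>\<bar>" and "b = sqrt \<beta>"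
  have "a \<noteq> 0" "b \<noteq> 0"
    using assms(1,2) by (auto simp: a_def b_def)
  have "t1 x + tj x * b = t1 y + tj y * b" "t1 x - tj x * b = t1 y - tj y * b"
    "ti x * a + tk x * (a * b) = ti y * a + tk y * (a * b)"
    "ti x * a - tk x * (a * b) = ti y * a - tk y * (a * b)"
    using assms(3,4) by (simp_all add: tess_eval_def complex_eq_iff a_def b_def)
  then have "t1 x = t1 y" "tj x * b = tj y * b" "ti x * a = ti y * a"
    "tk x * (a * b) = tk y * (a * b)"
    by linarith+
  then show ?thesis
    using \<open>a \<noteq> 0\<close> \<open>b \<noteq> 0\<close> by (simp add: tess.expand)
qed

text \<open>The scaled coordinates are combined with the sign patterns of the four characters of the
  Klein four-group. This sign matrix has orthogonal rows, hence is invertible.\<close>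

lemma tess_eqI_pos:
  assumes "\<alpha> > 0" and "\<beta> > 0"
    and "tess_eval (sqrt \<alpha>) (sqrt \<beta>) x = tess_eval (sqrt \<alpha>) (sqrt \<beta>) y"
    and "tess_eval (- sqrt \<alpha>) (sqrt \<beta>) x = tess_eval (- sqrt \<alpha>) (sqrt \<beta>) y"
    and "tess_eval (sqrt \<alpha>) (- sqrt \<beta>) x = tess_eval (sqrt \<alpha>) (- sqrt \<beta>) y"
    and "tess_eval (- sqrt \<alpha>) (- sqrt \<beta>) x = tess_eval (- sqrt \<alpha>) (- sqrt \<beta>) y"
  shows "x = y"
proof -
  define a b where "a = sqrt \<alpha>" and "b = sqrt \<beta>"
  have "a \<noteq> 0" "b \<noteq> 0"
    using assms(1,2) by (auto simp: a_def b_def)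
  have "t1 x + ti x * a + tj x * b + tk x * (a * b) = t1 y + ti y * a + tj y * b + tk y * (a * b)"
    "t1 x - ti x * a + tj x * b - tk x * (a * b) = t1 y - ti y * a + tj y * b - tk y * (a * b)"
    "t1 x + ti x * a - tj x * b - tk x * (a * b) = t1 y + ti y * a - tj y * b - tk y * (a * b)"
    "t1 x - ti x * a - tj x * b + tk x * (a * b) = t1 y - ti y * a - tj y * b + tk y * (a * b)"
    using assms(3-6) by (simp_all add: tess_eval_def a_def b_def)
  \<comment> \<open>The scaled coordinates act as unknowns of a linear system; the factors
    \<open>a\<close> and \<open>b\<close> are cancelled afterwards.\<close>
  then have "t1 x = t1 y" "ti x * a = ti y * a" "tj x * b = tj y * b"
    "tk x * (a * b) = tk y * (a * b)"
    by linarith+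
  then show ?thesis
    using \<open>a \<noteq> 0\<close> \<open>b \<noteq> 0\<close> by (simp add: tess.expand)
qed

section \<open>Reading off the table and the product formula\<close>

theorem corollary2:
  fixes \<alpha> \<beta> :: real and p :: nat and X P L U :: "tess mat" and \<gamma> :: "int list"
  assumes "\<alpha> \<noteq> 0" and "\<beta> > 0"
    and "X \<in> carrier_mat p p"
    and "tess_lu \<alpha> \<beta> X P L U \<gamma>"
  shows
    "(\<alpha> < 0 \<longrightarrow>
       (\<gamma>, det_over (tess_ring \<alpha> \<beta>) P) \<in>
         {([1, 1], 1),
          ([-1, -1], - 1),
          ([1, -1], (1 / sqrt \<beta>) *\<^sub>R unit_j),
          ([-1, 1], - (1 / sqrt \<beta>) *\<^sub>R unit_j)}) \<and>
     (\<alpha> > 0 \<longrightarrow>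
       (\<gamma>, det_over (tess_ring \<alpha> \<beta>) P) \<in>
         {([1, 1, 1, 1], 1),
          ([-1, -1, -1, -1], - 1),
          ([1, -1, 1, -1], (1 / sqrt \<alpha>) *\<^sub>R unit_i),
          ([-1, 1, -1, 1], - (1 / sqrt \<alpha>) *\<^sub>R unit_i),
          ([1, 1, -1, -1], (1 / sqrt \<beta>) *\<^sub>R unit_j),
          ([-1, -1, 1, 1], - (1 / sqrt \<beta>) *\<^sub>R unit_j),
          ([1, -1, -1, 1], (1 / sqrt (\<alpha> * \<beta>)) *\<^sub>R unit_k),
          ([-1, 1, 1, -1], - (1 / sqrt (\<alpha> * \<beta>)) *\<^sub>R unit_k),
          ([1, 1, 1, -1], a1 \<alpha> \<beta>),
          ([1, -1, 1, 1], conj_i (a1 \<alpha> \<beta>)),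
          ([1, 1, -1, 1], conj_j (a1 \<alpha> \<beta>)),
          ([-1, 1, 1, 1], conj_k (a1 \<alpha> \<beta>)),
          ([1, -1, -1, -1], a2 \<alpha> \<beta>),
          ([-1, -1, 1, -1], conj_i (a2 \<alpha> \<beta>)),
          ([-1, 1, -1, -1], conj_j (a2 \<alpha> \<beta>)),
          ([-1, -1, -1, 1], conj_k (a2 \<alpha> \<beta>))}) \<and>
     det_over (tess_ring \<alpha> \<beta>) X =
       det_over (tess_ring \<alpha> \<beta>) P \<otimes>\<^bsub>tess_ring \<alpha> \<beta>\<^esub>
         (\<Otimes>\<^bsub>tess_ring \<alpha> \<beta>\<^esub>i\<in>{0..<p}. U $$ (i, i))"
proof (cases "\<alpha> < 0")
  case True
  let ?r = "Complex 0 (sqrt \<bar>\<alpha>\<bar>)" and ?s = "of_real (sqrt \<beta>) :: complex"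
  let ?D = "det_over (tess_ring \<alpha> \<beta>)"
  have "?r * ?r = of_real \<alpha>" "?s * ?s = of_real \<beta>"
    using True assms(2) by (simp_all add: complex_eq_iff)
  then have roots: "tess_roots \<alpha> \<beta> ?r ?s" "tess_roots \<alpha> \<beta> ?r (- ?s)"
    by unfold_locales auto
  obtain g h where \<gamma>: "\<gamma> = [g, h]" and gh: "lu_det ?r ?s p g X P U" "lu_det ?r (- ?s) p h X P U"
    using tess_lu_neg[OF True assms(2-4)] by blast
  note eval = tess_roots.lu_det_tess_eval[OF roots(1) assms(3) gh(1)]
    tess_roots.lu_det_tess_eval[OF roots(2) assms(3) gh(2)]
  \<comment> \<open>A table entry is confirmed by its values alone: by joint injectivity, whatever
    evaluates to the two signatures equals \<open>det P\<close>.\<close>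
  have "?D P = x" if "tess_eval ?r ?s x = of_int g" "tess_eval ?r (- ?s) x = of_int h" for x
    using that eval by (intro tess_eqI_neg[OF True assms(2)]) simp_all
  moreover have "g \<in> {1, -1}" "h \<in> {1, -1}"
    using gh by (simp_all add: lu_det_def)
  moreover have "of_real (sqrt \<beta>) \<noteq> (0 :: complex)"
    using assms(2) by simp
  ultimately have "(\<gamma>, ?D P) \<in>
     {([1, 1], 1),
      ([-1, -1], - 1),
      ([1, -1], (1 / sqrt \<beta>) *\<^sub>R unit_j),
      ([-1, 1], - (1 / sqrt \<beta>) *\<^sub>R unit_j)}"
    using assms(2) unfolding \<gamma> by auto
  \<comment> \<open>The product formula holds under both evaluations, hence in the
    tessarines.\<close>
  then show ?thesis
    using tess_eqI_neg[OF True assms(2) eval(2,4)] True by simp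
next
  case False
  then have \<alpha>: "\<alpha> > 0"
    using assms(1) by simp
  let ?r = "sqrt \<alpha>" and ?s = "sqrt \<beta>"
  let ?D = "det_over (tess_ring \<alpha> \<beta>)"
  have roots: "tess_roots \<alpha> \<beta> ?r ?s" "tess_roots \<alpha> \<beta> (- ?r) ?s"
    "tess_roots \<alpha> \<beta> ?r (- ?s)" "tess_roots \<alpha> \<beta> (- ?r) (- ?s)"
    using \<alpha> assms(2) by unfold_locales auto
  obtain g1 g2 h1 h2 where \<gamma>: "\<gamma> = [g1, g2, h1, h2]"
    and gh: "lu_det ?r ?s p g1 X P U" "lu_det (- ?r) ?s p g2 X P U"
      "lu_det ?r (- ?s) p h1 X P U" "lu_det (- ?r) (- ?s) p h2 X P U"
    using tess_lu_pos[OF \<alpha> assms(2-4)] by blast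
  note eval = tess_roots.lu_det_tess_eval[OF roots(1) assms(3) gh(1)]
    tess_roots.lu_det_tess_eval[OF roots(2) assms(3) gh(2)]
    tess_roots.lu_det_tess_eval[OF roots(3) assms(3) gh(3)]
    tess_roots.lu_det_tess_eval[OF roots(4) assms(3) gh(4)]
  have D: "?D P = x"
    if "tess_eval ?r ?s x = of_int g1" "tess_eval (- ?r) ?s x = of_int g2"
      "tess_eval ?r (- ?s) x = of_int h1" "tess_eval (- ?r) (- ?s) x = of_int h2" for x
    using that eval by (intro tess_eqI_pos[OF \<alpha> assms(2)]) simp_all
  have pos: "?r > 0" "?s > 0"
    using \<alpha> assms(2) by simp_all
  have signs: "g1 \<in> {1, -1}" "g2 \<in> {1, -1}" "h1 \<in> {1, -1}" "h2 \<in> {1, -1}"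
    using gh by (simp_all add: lu_det_def)
  have "(\<gamma>, ?D P) \<in>
         {([1, 1, 1, 1], 1),
          ([-1, -1, -1, -1], - 1),
          ([1, -1, 1, -1], (1 / sqrt \<alpha>) *\<^sub>R unit_i),
          ([-1, 1, -1, 1], - (1 / sqrt \<alpha>) *\<^sub>R unit_i),
          ([1, 1, -1, -1], (1 / sqrt \<beta>) *\<^sub>R unit_j),
          ([-1, -1, 1, 1], - (1 / sqrt \<beta>) *\<^sub>R unit_j),
          ([1, -1, -1, 1], (1 / sqrt (\<alpha> * \<beta>)) *\<^sub>R unit_k),
          ([-1, 1, 1, -1], - (1 / sqrt (\<alpha> * \<beta>)) *\<^sub>R unit_k),
          ([1, 1, 1, -1], a1 \<alpha> \<beta>),
          ([1, -1, 1, 1], conj_i (a1 \<alpha> \<beta>)),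
          ([1, 1, -1, 1], conj_j (a1 \<alpha> \<beta>)),
          ([-1, 1, 1, 1], conj_k (a1 \<alpha> \<beta>)),
          ([1, -1, -1, -1], a2 \<alpha> \<beta>),
          ([-1, -1, 1, -1], conj_i (a2 \<alpha> \<beta>)),
          ([-1, 1, -1, -1], conj_j (a2 \<alpha> \<beta>)),
          ([-1, -1, -1, 1], conj_k (a2 \<alpha> \<beta>))}"
    \<comment> \<open>All 16 sign vectors are tried against \<open>D\<close>. An even number of -1
      leads to 1 or a scaled unit, up to sign; a single -1 to a conjugate of \<open>a1\<close>, and
      three to a conjugate of \<open>a2\<close>. Splitting \<open>sqrt (\<alpha> * \<beta>)\<close>
      lets the coefficient of \<open>unit_k\<close> cancel against the product of the roots.\<close>
    using signs pos unfolding \<gamma> insert_iff empty_iff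
    by (elim disjE; simp; intro D; simp add: a1_def a2_def real_sqrt_mult)
  then show ?thesis
    using tess_eqI_pos[OF \<alpha> assms(2) eval(2,4,6,8)] \<alpha> by simp
qed

end
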